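(* Let $\varepsilon_1<\varepsilon_2$ be real numbers (acceptable violation probabilities), and let $B_{\mathbf{x}}\subseteq\mathbb{R}^n$, $Y\subseteq\mathbb{R}^m$, the polynomials $f=\sum_{i=1}^m f_i^2$ and $g_1,\ldots,g_k$ in $\mathbb{R}[\mathbf{x},\mathbf{y},\boldsymbol{\omega}]$, and the probability $\mathbb{P}_{\boldsymbol{\omega}}$ be as in the context. Define $$\mathcal{L}^{\mathbf{x}}:=\Big\{\mathbf{x}\in\mathbb{R}^n:\ \mathbb{P}_{\boldsymbol{\omega}}\big(\exists\,\mathbf{y}\in Y,\ f(\mathbf{x},\mathbf{y},\boldsymbol{\omega})=0\big)\geq 1-\varepsilon_1,\ \ \mathbb{P}_{\boldsymbol{\omega}}\big(\exists\,\mathbf{y}\in Y,\ f(\mathbf{x},\mathbf{y},\boldsymbol{\omega})=0\ \wedge\ g_j(\mathbf{x},\mathbf{y},\boldsymbol{\omega})\geq 0\big)\geq 1-\varepsilon_2,\ j=1,\ldots,k\Big\},$$ where it is assumed that $\mathcal{L}^{\mathbf{x}}\subseteq B_{\mathbf{x}}$, and $$K^{\mathbf{x}}:=\Big\{\mathbf{x}\in B_{\mathbf{x}}:\ \mathbb{P}_{\boldsymbol{\omega}}\big(\exists\,\mathbf{y}\in Y,\ f(\mathbf{x},\mathbf{y},\boldsymbol{\omega})=0\big)\geq 1-\varepsilon_1,\ \ \mathbb{P}_{\boldsymbol{\omega}}\big(\exists\,\mathbf{y}\in Y,\ f(\mathbf{x},\mathbf{y},\boldsymbol{\omega})=0\ \wedge\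 g_j(\mathbf{x},\mathbf{y},\boldsymbol{\omega})\leq 0\big)\leq \varepsilon_2-\varepsilon_1,\ j=1,\ldots,k\Big\}.$$ Then $K^{\mathbf{x}}$ is an inner approximation of $\mathcal{L}^{\mathbf{x}}$, i.e. $K^{\mathbf{x}}\subseteq\mathcal{L}^{\mathbf{x}}$.
   Context: Variables: $\mathbf{x}=(x_1,\ldots,x_n)$ (decision variables), $\mathbf{y}=(y_1,\ldots,y_m)$ (dependent variables), $\boldsymbol{\omega}=(w_1,\ldots,w_\ell)$ (uncertain parameters). $(\Omega,\mu)$ is a probability space with $\Omega\subseteq\mathbb{R}^\ell$; $\boldsymbol{\omega}\in\Omega$ is distributed according to $\mu$ and has zero mean. For a measurable event $A\subseteq\Omega$, $\mathbb{P}_{\boldsymbol{\omega}}(A)=\int_A 1\,\mu(d\boldsymbol{\omega})$. For fixed $\mathbf{x}$, an expression $\mathbb{P}_{\boldsymbol{\omega}}(\text{condition on }\boldsymbol{\omega})$ denotes the probability of the set of $\boldsymbol{\omega}\in\Omega$ satisfying the condition; all the events appearing are assumed measurable. $f_1,\ldots,f_m,g_1,\ldots,g_k\in\mathbb{R}[\mathbf{x},\mathbf{y},\boldsymbol{\omega}]$ are real multivariate polynomials, and $f:=\sum_{i=1}^m f_i^2$, so that $f=0$ is equivalent to $f_1=\cdots=f_m=0$. $B_{\mathbf{x}}\subseteq\mathbb{R}^n$ is a hyper-interval (box) or another simple shape for which the moments of the Lebesgue measure are known. $Y\subseteq\mathbb{R}^m$ is a set satisfying the standing assumption that, for given $\mathbf{x}$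 and $\boldsymbol{\omega}$, the solution $\mathbf{y}\in Y$ of $f(\mathbf{x},\mathbf{y},\boldsymbol{\omega})=0$ is unique whenever it exists. "Inner approximation" of a set means a subset of that set. *)

theory Defs
  imports "HOL-Probability.Probability"
begin

text \<open>
  Points \<open>(x, y, \<omega>)\<close> live in \<open>real^'n \<times> real^'m \<times> real^'l\<close>. A polynomial over the reals is
  identified with the function it induces, and is therefore expressed by
  \<^const>\<open>real_polynomial_function\<close>; over an infinite field, and in finitely many coordinates, this
  identification is one-to-one. The system \<open>f\<^sub>1 = \<dots> = f\<^sub>m = 0\<close> has as many equations as \<open>y\<close> has
  components, so the equations are indexed by the type \<open>'m\<close>.
\<close>

definition sum_of_squares ::
    "('m::finite \<Rightarrow> 'a \<Rightarrow> real) \<Rightarrow> 'a \<Rightarrow> real" where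
  "sum_of_squares F z = (\<Sum>i\<in>UNIV. (F i z)\<^sup>2)"

text \<open>
  All moments of the Lebesgue measure on \<open>B\<close> exist; the exponent \<open>\<alpha> = 0\<close> makes \<open>B\<close> itself
  Lebesgue measurable with finite volume. Bounded boxes are the typical example.
\<close>

definition has_lebesgue_moments :: "(real^'n) set \<Rightarrow> bool" where
  "has_lebesgue_moments B \<longleftrightarrow>
     (\<forall>\<alpha> :: 'n \<Rightarrow> nat. (\<lambda>x. \<Prod>i\<in>UNIV. (x $ i) ^ \<alpha> i) absolutely_integrable_on B)"

definition solvable ::
    "(real^'m) set \<Rightarrow> ((real^'n) \<times> (real^'m) \<times> (real^'l) \<Rightarrow> real) \<Rightarrow> real^'n \<Rightarrow> real^'l \<Rightarrow> bool" where
  "solvable Y f x \<omega> \<longleftrightarrow> (\<exists>y\<in>Y. f (x, y, \<omega>) = 0)"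

definition solvable_ge ::
    "(real^'m) set \<Rightarrow> ((real^'n) \<times> (real^'m) \<times> (real^'l) \<Rightarrow> real) \<Rightarrow>
     ((real^'n) \<times> (real^'m) \<times> (real^'l) \<Rightarrow> real) \<Rightarrow> real^'n \<Rightarrow> real^'l \<Rightarrow> bool" where
  "solvable_ge Y f h x \<omega> \<longleftrightarrow> (\<exists>y\<in>Y. f (x, y, \<omega>) = 0 \<and> h (x, y, \<omega>) \<ge> 0)"

definition solvable_le ::
    "(real^'m) set \<Rightarrow> ((real^'n) \<times> (real^'m) \<times> (real^'l) \<Rightarrow> real) \<Rightarrow>
     ((real^'n) \<times> (real^'m) \<times> (real^'l) \<Rightarrow> real) \<Rightarrow> real^'n \<Rightarrow> real^'l \<Rightarrow> bool" where
  "solvable_le Y f h x \<omega> \<longleftrightarrow> (\<exists>y\<in>Y. f (x, y, \<omega>) = 0 \<and> h (x, y, \<omega>) \<le> 0)"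

text \<open>
  The probability space \<open>(\<Omega>, \<mu>)\<close> is the measure \<open>M\<close> with \<open>\<Omega> = space M\<close>.
\<close>

definition L_set ::
    "(real^'l) measure \<Rightarrow> (real^'m) set \<Rightarrow> ((real^'n) \<times> (real^'m) \<times> (real^'l) \<Rightarrow> real) \<Rightarrow>
     nat \<Rightarrow> (nat \<Rightarrow> (real^'n) \<times> (real^'m) \<times> (real^'l) \<Rightarrow> real) \<Rightarrow> real \<Rightarrow> real \<Rightarrow> (real^'n) set" where
  "L_set M Y f k g \<epsilon>\<^sub>1 \<epsilon>\<^sub>2 =
     {x. \<P>(\<omega> in M. solvable Y f x \<omega>) \<ge> 1 - \<epsilon>\<^sub>1 \<and>
         (\<forall>j\<in>{1..k}. \<P>(\<omega> in M. solvable_ge Y f (g j) x \<omega>) \<ge> 1 - \<epsilon>\<^sub>2)}"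

definition K_set ::
    "(real^'l) measure \<Rightarrow> (real^'n) set \<Rightarrow> (real^'m) set \<Rightarrow>
     ((real^'n) \<times> (real^'m) \<times> (real^'l) \<Rightarrow> real) \<Rightarrow>
     nat \<Rightarrow> (nat \<Rightarrow> (real^'n) \<times> (real^'m) \<times> (real^'l) \<Rightarrow> real) \<Rightarrow> real \<Rightarrow> real \<Rightarrow> (real^'n) set" where
  "K_set M B Y f k g \<epsilon>\<^sub>1 \<epsilon>\<^sub>2 =
     {x\<in>B. \<P>(\<omega> in M. solvable Y f x \<omega>) \<ge> 1 - \<epsilon>\<^sub>1 \<and>
           (\<forall>j\<in>{1..k}. \<P>(\<omega> in M. solvable_le Y f (g j) x \<omega>) \<le> \<epsilon>\<^sub>2 - \<epsilon>\<^sub>1)}"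

end

theory Submission
  imports Defs
begin

text \<open>
  Let \<open>h\<close> be one of the \<open>g j\<close>. At a solution \<open>y\<close> of \<open>f (x, y, \<omega>) = 0\<close> its value is nonnegative or
  nonpositive, so every \<open>\<omega>\<close> for which the system is solvable lies in the safe event (a solution
  with \<open>h \<ge> 0\<close>) or in the violation event (a solution with \<open>h \<le> 0\<close>). By the union bound, the
  safe event has probability at least that of solvability minus that of violation. At a point of
  \<^const>\<open>K_set\<close> this difference is at least \<open>(1 - \<epsilon>\<^sub>1) - (\<epsilon>\<^sub>2 - \<epsilon>\<^sub>1) = 1 - \<epsilon>\<^sub>2\<close>, which is the
  requirement on \<open>h\<close> in \<^const>\<open>L_set\<close>; the requirement of solvability is common to both sets.
\<close>

lemma solvable_imp_ge_or_le:
  assumes "solvable Y f x \<omega>"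
  shows "solvable_ge Y f h x \<omega> \<or> solvable_le Y f h x \<omega>"
  using assms unfolding solvable_def solvable_ge_def solvable_le_def
  by (meson linear)

text \<open>
  The inequality can be strict: an \<open>\<omega>\<close> for which \<open>h\<close> vanishes at a solution is counted twice on
  the right-hand side.
\<close>

lemma prob_solvable_le_prob_ge_plus_prob_le:
  fixes M :: "(real^'l) measure"
  assumes "prob_space M"
    and ge: "{\<omega> \<in> space M. solvable_ge Y f h x \<omega>} \<in> sets M"
    and le: "{\<omega> \<in> space M. solvable_le Y f h x \<omega>} \<in> sets M"
  shows "\<P>(\<omega> in M. solvable Y f x \<omega>)
    \<le> \<P>(\<omega> in M. solvable_ge Y f h x \<omega>) + \<P>(\<omega> in M. solvable_le Y f h x \<omega>)"
proof -
  interpret prob_space M by fact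
  have "\<P>(\<omega> in M. solvable Y f x \<omega>)
      \<le> prob ({\<omega> \<in> space M. solvable_ge Y f h x \<omega>} \<union> {\<omega> \<in> space M. solvable_le Y f h x \<omega>})"
    using ge le by (intro finite_measure_mono) (auto dest: solvable_imp_ge_or_le)
  also have "\<dots> \<le> \<P>(\<omega> in M. solvable_ge Y f h x \<omega>) + \<P>(\<omega> in M. solvable_le Y f h x \<omega>)"
    using ge le by (rule measure_Un_le)
  finally show ?thesis .
qed

theorem proposition1:
  fixes M :: "(real^'l) measure"
    and B :: "(real^'n) set"
    and Y :: "(real^'m) set"
    and F :: "'m \<Rightarrow> (real^'n) \<times> (real^'m) \<times> (real^'l) \<Rightarrow> real"
    and f :: "(real^'n) \<times> (real^'m) \<times> (real^'l) \<Rightarrow> real"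
    and g :: "nat \<Rightarrow> (real^'n) \<times> (real^'m) \<times> (real^'l) \<Rightarrow> real"
    and k :: nat
    and \<epsilon>\<^sub>1 \<epsilon>\<^sub>2 :: real
  assumes eps: "\<epsilon>\<^sub>1 < \<epsilon>\<^sub>2"
    and prob: "prob_space M"
    and mean_exists: "integrable M (\<lambda>\<omega>. \<omega>)"
    and zero_mean: "(LINT \<omega>|M. \<omega>) = 0"
    and poly_F: "\<And>i. real_polynomial_function (F i)"
    and f_eq: "f = sum_of_squares F"
    and poly_g: "\<And>j. j \<in> {1..k} \<Longrightarrow> real_polynomial_function (g j)"
    and moments_B: "has_lebesgue_moments B"
    and unique: "\<And>x \<omega> y y'. \<omega> \<in> space M \<Longrightarrow> y \<in> Y \<Longrightarrow> y' \<in> Y \<Longrightarrow>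
                   f (x, y, \<omega>) = 0 \<Longrightarrow> f (x, y', \<omega>) = 0 \<Longrightarrow> y = y'"
    and meas: "\<And>x. {\<omega> \<in> space M. solvable Y f x \<omega>} \<in> sets M"
    and meas_ge: "\<And>x j. j \<in> {1..k} \<Longrightarrow> {\<omega> \<in> space M. solvable_ge Y f (g j) x \<omega>} \<in> sets M"
    and meas_le: "\<And>x j. x \<in> B \<Longrightarrow> j \<in> {1..k} \<Longrightarrow>
                   {\<omega> \<in> space M. solvable_le Y f (g j) x \<omega>} \<in> sets M"
    and L_sub_B: "L_set M Y f k g \<epsilon>\<^sub>1 \<epsilon>\<^sub>2 \<subseteq> B"
  shows "K_set M B Y f k g \<epsilon>\<^sub>1 \<epsilon>\<^sub>2 \<subseteq> L_set M Y f k g \<epsilon>\<^sub>1 \<epsilon>\<^sub>2"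
proof
  fix x assume x: "x \<in> K_set M B Y f k g \<epsilon>\<^sub>1 \<epsilon>\<^sub>2"
  then have "x \<in> B" and solv: "\<P>(\<omega> in M. solvable Y f x \<omega>) \<ge> 1 - \<epsilon>\<^sub>1"
    by (auto simp: K_set_def)
  have "\<P>(\<omega> in M. solvable_ge Y f (g j) x \<omega>) \<ge> 1 - \<epsilon>\<^sub>2" if j: "j \<in> {1..k}" for j
  proof -
    have "\<P>(\<omega> in M. solvable_le Y f (g j) x \<omega>) \<le> \<epsilon>\<^sub>2 - \<epsilon>\<^sub>1"
      using x j by (auto simp: K_set_def)
    with prob_solvable_le_prob_ge_plus_prob_le [OF prob meas_ge [OF j] meas_le [OF \<open>x \<in> B\<close> j]]
      solv
    show ?thesis by linarith
  qed
  with solv show "x \<in> L_set M Y f k g \<epsilon>\<^sub>1 \<epsilon>\<^sub>2"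
    by (simp add: L_set_def)
qed

end
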